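(* Let $n\ge6$ and let $\beta>1$ be a real number with $\mathrm{dyg}(\beta)=n$. Then $\beta=\mathrm{D}(\beta)+\mathrm{tl}(\beta)$ with $$\mathrm{D}(\beta)=1+\frac{\log n}{n}\Big(1-\Big(\frac{n-\log n}{n\log n+n-\log n}\Big)\Big(\log\log n-n\log\Big(1-\frac{\log n}{n}\Big)-\log n\Big)\Big)$$ and $$\mathrm{tl}(\beta)=\frac1n\,O\Big(\Big(\frac{\log\log n}{\log n}\Big)^2\Big),$$ with the constant $1$ involved in the $O$.
   Context: For $n\ge2$, $\theta_n$ is the unique root in $(0,1)$ of $-1+z+z^n$; for real $1<\beta\le(1+\sqrt5)/2$, $\mathrm{dyg}(\beta)$ is the unique integer $n\ge3$ with $\theta_n^{-1}\le\beta<\theta_{n-1}^{-1}$. *)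

theory Defs
  imports Complex_Main
begin

definition theta :: "nat \<Rightarrow> real" where
  "theta n = (THE z. 0 < z \<and> z < 1 \<and> -1 + z + z ^ n = 0)"

definition is_dyg :: "real \<Rightarrow> nat \<Rightarrow> bool" where
  "is_dyg \<beta> n \<longleftrightarrow>
     1 < \<beta> \<and> \<beta> \<le> (1 + sqrt 5) / 2 \<and> n \<ge> 3 \<and>
     inverse (theta n) \<le> \<beta> \<and> \<beta> < inverse (theta (n - 1))"

(* The value 0 marks the numbers that have no dynamical degree: those outside the
   domain, and the endpoint (1 + sqrt 5)/2 = 1/theta 2, which the half-open
   intervals indexed by n \<ge> 3 do not cover. Hence dyg \<beta> = n with n > 0
   always means that the defining inequalities hold. *)
definition dyg :: "real \<Rightarrow> nat" where
  "dyg \<beta> = (if \<exists>!n. is_dyg \<beta> n then (THE n. is_dyg \<beta> n) else 0)"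

definition D :: "real \<Rightarrow> real" where
  "D \<beta> = (let n = real (dyg \<beta>) in
     1 + ln n / n *
       (1 - ((n - ln n) / (n * ln n + n - ln n)) *
              (ln (ln n) - n * ln (1 - ln n / n) - ln n)))"

end

theory Submission
  imports Defs "HOL-Real_Asymp.Real_Asymp"
begin

text \<open>
  The reciprocal \<open>b = 1 / \<theta>\<^sub>m\<close> is the zero of the increasing function
  \<open>c \<mapsto> ln (c - 1) + (m - 1) * ln c\<close>, so its position relative to an explicit \<open>c\<close> is read off
  the sign of this function at \<open>c\<close>. Writing \<open>L = ln n\<close> and \<open>l = ln L\<close>, the zero is
  \<open>1 + (L - l + l / L + l\<^sup>2 / (2 * L\<^sup>2) + O(l / L\<^sup>2)) / n\<close> for both \<open>m = n\<close> and \<open>m = n - 1\<close>, whereas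
  the main term is \<open>1 + (L - l + l / (L + 1) + O(L\<^sup>2 / n)) / n\<close>. The difference is
  asymptotically \<open>l\<^sup>2 / (2 * L\<^sup>2 * n)\<close>, which leaves room for the constant 1.
\<close>

text \<open>\<open>D\<close> depends on \<open>\<beta>\<close> only through the integer
  \<open>dyg \<beta>\<close>. A real argument makes asymptotic expansion at infinity
  possible.\<close>

definition main_term :: "real \<Rightarrow> real" where
  "main_term x = 1 + ln x / x *
     (1 - ((x - ln x) / (x * ln x + x - ln x)) * (ln (ln x) - x * ln (1 - ln x / x) - ln x))"

definition error_term :: "real \<Rightarrow> real" where
  "error_term x = 1 / x * (ln (ln x) / ln x)\<^sup>2"

lemma D_eq_main_term: "D \<beta> = main_term (real (dyg \<beta>))"
  by (simp add: D_def main_term_def Let_def)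

lemma is_dyg_dyg:
  assumes "dyg \<beta> \<noteq> 0"
  shows "is_dyg \<beta> (dyg \<beta>)"
proof -
  have ex: "\<exists>!n. is_dyg \<beta> n"
    using assms by (auto simp: dyg_def split: if_splits)
  then show ?thesis
    using theI'[OF ex] by (simp add: dyg_def)
qed

text \<open>The definite description needs existence, from the intermediate value theorem on [0,1],
  and uniqueness, since z + z^n increases strictly there.\<close>

lemma theta_root:
  assumes "n \<ge> 2"
  shows "0 < theta n" "theta n < 1" "theta n + theta n ^ n = 1"
proof -
  let ?P = "\<lambda>z::real. 0 < z \<and> z < 1 \<and> -1 + z + z ^ n = 0"
  have "\<exists>z\<ge>0. z \<le> 1 \<and> -1 + z + z ^ n = (0::real)"
    using assms by (intro IVT') (auto intro!: continuous_intros simp: power_0_left)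
  then obtain z :: real where z: "0 \<le> z" "z \<le> 1" "-1 + z + z ^ n = 0"
    by blast
  then have "z \<noteq> 0" "z \<noteq> 1"
    using assms by (auto simp: power_0_left)
  then have Pz: "?P z"
    using z by auto
  have "w = z" if "?P w" for w
  proof (rule linorder_cases[of w z])
    assume "w < z"
    then have "w ^ n \<le> z ^ n" using that by (intro power_mono) auto
    then show ?thesis using that Pz \<open>w < z\<close> by linarith
  next
    assume "z < w"
    then have "z ^ n \<le> w ^ n" using Pz by (intro power_mono) auto
    then show ?thesis using that Pz \<open>z < w\<close> by linarith
  qed
  with Pz have "?P (theta n)"
    unfolding theta_def by (rule theI)
  then show "0 < theta n" "theta n < 1" "theta n + theta n ^ n = 1"
    by auto
qed

text \<open>With c = 1/z the equation z + z^m = 1 becomes (c - 1) * c^(m - 1) = 1; this is the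
  logarithm of the left side, with m real.\<close>

definition log_defect :: "real \<Rightarrow> real \<Rightarrow> real" where
  "log_defect m c = ln (c - 1) + (m - 1) * ln c"

lemma log_defect_mono:
  assumes "1 < c" "c \<le> d" "1 \<le> m"
  shows "log_defect m c \<le> log_defect m d"
  unfolding log_defect_def using assms by (intro add_mono mult_left_mono) auto

lemma log_defect_inverse_theta:
  assumes "n \<ge> 2"
  shows "log_defect (real n) (inverse (theta n)) = 0"
proof -
  note t = theta_root[OF assms]
  have "inverse (theta n) - 1 = (1 - theta n) / theta n"
    using t by (simp add: field_simps)
  also have "1 - theta n = theta n ^ n"
    using t by simp
  finally have "ln (inverse (theta n) - 1) = real n * ln (theta n) - ln (theta n)"
    using t by (simp add: ln_div ln_realpow)
  then show ?thesis
    using t by (simp add: log_defect_def ln_inverse algebra_simps)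
qed

text \<open>If the claim failed, c would be at least \<open>inverse (theta n)\<close> > 1, where
  monotonicity contradicts the sign.\<close>

lemma less_inverse_theta:
  assumes "n \<ge> 2" "log_defect (real n) c < 0"
  shows "c < inverse (theta n)"
proof (rule ccontr)
  assume "\<not> c < inverse (theta n)"
  then have "log_defect (real n) (inverse (theta n)) \<le> log_defect (real n) c"
    using assms theta_root[OF assms(1)]
    by (intro log_defect_mono) (auto simp: one_less_inverse)
  then show False
    using assms log_defect_inverse_theta[OF assms(1)] by simp
qed

text \<open>Here the negated claim bounds c only from above, so \<open>1 < c\<close> is assumed to
  stay where \<open>log_defect\<close> is monotone.\<close>

lemma inverse_theta_less:
  assumes "n \<ge> 2" "1 < c" "log_defect (real n) c > 0"
  shows "inverse (theta n) < c"
proof (rule ccontr)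
  assume "\<not> inverse (theta n) < c"
  then have "log_defect (real n) c \<le> log_defect (real n) (inverse (theta n))"
    using assms by (intro log_defect_mono) auto
  then show False
    using assms log_defect_inverse_theta[OF assms(1)] by simp
qed

text \<open>The second sign is taken at \<open>x - 1\<close> because the interval of degree n ends
  at \<open>inverse (theta (n - 1))\<close>. The third fact supplies the condition
  \<open>1 < c\<close> there.\<close>

lemma eventually_log_defect_signs:
  "\<forall>\<^sub>F x in at_top. log_defect x (main_term x - error_term x) < 0"
  "\<forall>\<^sub>F x in at_top. log_defect (x - 1) (main_term x + error_term x) > 0"
  "\<forall>\<^sub>F x in at_top. main_term x + error_term x > 1"
  unfolding log_defect_def main_term_def error_term_def by real_asymp+

lemma eventually_dist_main_term_le:
  "\<forall>\<^sub>F n in sequentially. \<forall>\<beta>. dyg \<beta> = n \<longrightarrow> \<bar>\<beta> - main_term (real n)\<bar> \<le> error_term (real n)"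
proof -
  note ev = eventually_log_defect_signs
    [THEN eventually_compose_filterlim[OF _ filterlim_real_sequentially]]
  show ?thesis
    \<comment> \<open>The bound 3 rules out the default value 0 of \<open>dyg\<close> and gives
      \<open>n - 1 \<ge> 2\<close>, so that \<open>theta (n - 1)\<close> is a genuine root.\<close>
    using ev eventually_ge_at_top[of 3]
  proof eventually_elim
    case (elim n)
    show ?case
    proof (intro allI impI)
      fix \<beta> assume "dyg \<beta> = n"
      with elim is_dyg_dyg[of \<beta>] have "is_dyg \<beta> n"
        by auto
      then have "inverse (theta n) \<le> \<beta>" "\<beta> < inverse (theta (n - 1))"
        by (auto simp: is_dyg_def)
      moreover have "main_term (real n) - error_term (real n) < inverse (theta n)"
        using elim by (intro less_inverse_theta) auto
      moreover have "inverse (theta (n - 1)) < main_term (real n) + error_term (real n)"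
        using elim by (intro inverse_theta_less) (auto simp: of_nat_diff)
      ultimately show "\<bar>\<beta> - main_term (real n)\<bar> \<le> error_term (real n)"
        by linarith
    qed
  qed
qed

text \<open>The threshold is e because ln (ln x) vanishes there; positivity allows division by the
  error term.\<close>

lemma error_term_pos:
  assumes "x > exp 1"
  shows "error_term x > 0"
proof -
  have "x > 0"
    using assms exp_gt_zero[of "1::real"] by linarith
  then have "ln x > 1"
    using assms ln_less_cancel_iff[of "exp 1" x] by simp
  then have "ln (ln x) / ln x > 0"
    by simp
  with \<open>x > 0\<close> show ?thesis
    by (simp only: error_term_def zero_less_power zero_less_divide_1_iff mult_pos_pos)
qed

text \<open>Only finitely many n lie below the asymptotic range, and for each of them \<beta> is
  bounded, so a larger constant absorbs them.\<close>

lemma dist_main_term_le: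
  "\<exists>C. \<forall>n\<ge>6. \<forall>\<beta>. dyg \<beta> = n \<longrightarrow> \<bar>\<beta> - main_term (real n)\<bar> \<le> C * error_term (real n)"
proof -
  obtain N where N: "\<And>n \<beta>. n \<ge> N \<Longrightarrow> dyg \<beta> = n \<Longrightarrow>
      \<bar>\<beta> - main_term (real n)\<bar> \<le> error_term (real n)"
    using eventually_dist_main_term_le unfolding eventually_sequentially by blast
  \<comment> \<open>The 2 bounds \<beta>, since (1 + sqrt 5) / 2 \<le> 2.\<close>
  define B where "B n = (2 + \<bar>main_term (real n)\<bar>) / error_term (real n)" for n
  \<comment> \<open>The summand 1 serves n \<ge> N; the sum of absolute values dominates each
    \<open>B n\<close> with n < N.\<close>
  define C where "C = 1 + (\<Sum>n<N. \<bar>B n\<bar>)"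
  have "\<bar>\<beta> - main_term (real n)\<bar> \<le> C * error_term (real n)" if n: "n \<ge> 6" "dyg \<beta> = n" for n \<beta>
  proof -
    have pos: "error_term (real n) > 0"
      using n exp_le by (intro error_term_pos) linarith
    have "\<bar>\<beta> - main_term (real n)\<bar> \<le> \<bar>B n\<bar> * error_term (real n)" if "n < N"
    proof -
      have "is_dyg \<beta> n"
        using is_dyg_dyg[of \<beta>] n by auto
      moreover have "sqrt 5 \<le> 3"
        by (rule real_le_lsqrt) auto
      ultimately have "\<bar>\<beta> - main_term (real n)\<bar> \<le> 2 + \<bar>main_term (real n)\<bar>"
        by (auto simp: is_dyg_def)
      also have "\<dots> = B n * error_term (real n)"
        using pos by (simp add: B_def)
      also have "\<dots> \<le> \<bar>B n\<bar> * error_term (real n)"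
        using pos by (intro mult_right_mono) auto
      finally show ?thesis .
    qed
    moreover have "\<bar>B n\<bar> \<le> C" if "n < N"
      using member_le_sum[of n "{..<N}" "\<lambda>n. \<bar>B n\<bar>"] that by (auto simp: C_def)
    moreover have "1 \<le> C"
      by (simp add: C_def sum_nonneg)
    ultimately show ?thesis
      using N[of n \<beta>] n pos mult_right_mono[of _ C "error_term (real n)"]
      by (cases "n < N") (force intro: order_trans)+
  qed
  then show ?thesis
    by blast
qed

text \<open>The O with constant 1 is read asymptotically: the constant 1 for all large n, and some
  constant over the whole range n \<ge> 6, both for the same remainder.\<close>

theorem theorem5p2:
  shows "\<exists>tl :: real \<Rightarrow> real.
    (\<forall>n\<ge>6. \<forall>\<beta>>1. dyg \<beta> = n \<longrightarrow> \<beta> = D \<beta> + tl \<beta>) \<and>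
    (\<exists>C. \<forall>n\<ge>6. \<forall>\<beta>>1. dyg \<beta> = n \<longrightarrow>
        \<bar>tl \<beta>\<bar> \<le> 1 / real n * (C * (ln (ln (real n)) / ln (real n))\<^sup>2)) \<and>
    (\<forall>\<^sub>F n in sequentially. \<forall>\<beta>>1. dyg \<beta> = n \<longrightarrow>
        \<bar>tl \<beta>\<bar> \<le> 1 / real n * (1 * (ln (ln (real n)) / ln (real n))\<^sup>2))"
proof (rule exI[of _ "\<lambda>\<beta>. \<beta> - D \<beta>"], intro conjI)
  show "\<forall>n\<ge>6. \<forall>\<beta>>1. dyg \<beta> = n \<longrightarrow> \<beta> = D \<beta> + (\<beta> - D \<beta>)"
    by simp
  show "\<exists>C. \<forall>n\<ge>6. \<forall>\<beta>>1. dyg \<beta> = n \<longrightarrow>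
      \<bar>\<beta> - D \<beta>\<bar> \<le> 1 / real n * (C * (ln (ln (real n)) / ln (real n))\<^sup>2)"
    using dist_main_term_le by (simp add: D_eq_main_term error_term_def mult_ac) blast
  show "\<forall>\<^sub>F n in sequentially. \<forall>\<beta>>1. dyg \<beta> = n \<longrightarrow>
      \<bar>\<beta> - D \<beta>\<bar> \<le> 1 / real n * (1 * (ln (ln (real n)) / ln (real n))\<^sup>2)"
    using eventually_dist_main_term_le
    by eventually_elim (auto simp: D_eq_main_term error_term_def)
qed

end
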